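(* Let $d\ge 0$. For all multi-indices $\alpha,\beta$ of length $d+1$ with $|\alpha|=|\beta|$, the homogeneous polynomials $h_\alpha$ and the bilinear form $\langle\langle\cdot,\cdot\rangle\rangle$ defined in the context satisfy: (1) if $d\ge 1$, $$\langle\langle h_\alpha,h_\alpha\rangle\rangle=\alpha_d!\,\frac{(2|\alpha'|+d)!!\,(2|\alpha|+d-1)!!}{(|\alpha'|+|\alpha|+d)!}\,\langle\langle h_{\alpha'},h_{\alpha'}\rangle\rangle,$$ where $\langle\langle h_{\alpha'},h_{\alpha'}\rangle\rangle$ is taken with respect to the form in $d$ variables; (2) $\langle\langle h_\alpha,h_\beta\rangle\rangle=0$ if $\alpha\ne\beta$; (3) $\langle\langle x^\alpha,h_\alpha\rangle\rangle=\langle\langle h_\alpha,h_\alpha\rangle\rangle$; (4) $\langle\langle x^\alpha,h_\beta\rangle\rangle=0$ if $\alpha<\beta$.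
   Context: Multi-indices $\alpha=(\alpha_0,\ldots,\alpha_d)$ have nonnegative integer entries; $|\alpha|=\sum_i\alpha_i$, $x^\alpha=x_0^{\alpha_0}\cdots x_d^{\alpha_d}$, $\alpha'=(\alpha_0,\ldots,\alpha_{d-1})$, and for $x=(x_0,\ldots,x_d)$, $x'=(x_0,\ldots,x_{d-1})$. Ordering on multi-indices of equal length (recursively): $\alpha<\beta$ iff $\alpha_d<\beta_d$, or $\alpha_d=\beta_d$ and $\alpha'<\beta'$. Double factorial: for $n\ge -1$, $n!!=n(n-2)(n-4)\cdots$ (product of the positive terms), with $0!!=(-1)!!=1$. The form in $d+1$ variables is $\langle\langle f,g\rangle\rangle=(2\pi)^{-\frac{d+1}{2}}\int_{\mathbb{R}^{d+1}}f(x)g(x)e^{-\frac12\|x\|^2}dx$ for polynomials $f,g\in\mathbb{R}[x_0,\ldots,x_d]$. For integers $n,m$ with $0\le 2n\le m+1$, let $$p_n^m(x)=\sum_{\substack{0\le j\le n\\ n-j\text{ even}}}(-1)^{\frac{n-j}{2}}\frac{n!\,(m-2n)!!}{j!\,(m-n-j)!!\,(n-j)!!}\,x^j .$$ The polynomials $h_\alpha$, homogeneous of degree $|\alpha|$, are defined recursively by $h_{(\alpha_0)}(x)=x_0^{\alpha_0}$ and, for $d\ge1$, $$h_\alpha(x)=p_{\alpha_d}^{2|\alpha|+d}\!\left(\frac{x_d}{r}\right)r^{\alpha_d}\,h_{\alpha'}(x'),\qquad r=\sqrt{x_0^2+\cdots+x_{d-1}^2}$$ (only even powers of $r$ appear after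 expansion, so this is a polynomial). *)

theory Defs
  imports "HOL-Analysis.Analysis" "HOL-Computational_Algebra.Polynomial"
begin

definition double_fact :: "int \<Rightarrow> int" where
  "double_fact n = \<Prod>{k. 0 < k \<and> k \<le> n \<and> even (n - k)}"

lemma double_fact_nonpos: "n \<le> 0 \<Longrightarrow> double_fact n = 1"
proof -
  assume "n \<le> 0"
  then have "{k. 0 < k \<and> k \<le> n \<and> even (n - k)} = {}" by auto
  then show ?thesis by (simp only: double_fact_def prod.empty)
qed

lemma double_fact_rec: "0 < n \<Longrightarrow> double_fact n = n * double_fact (n - 2)"
proof -
  assume n: "0 < n"
  let ?A = "\<lambda>n::int. {k. 0 < k \<and> k \<le> n \<and> even (n - k)}"
  have "k \<le> n - 2" if "k \<le> n" "k \<noteq> n" "even (n - k)" for k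
    using that by presburger
  then have "?A n = insert n (?A (n - 2))" using n by auto
  moreover have "finite (?A (n - 2))"
    by (rule finite_subset[of _ "{0..n}"]) auto
  ultimately show ?thesis by (simp add: double_fact_def)
qed

text \<open>The polynomial $p_n^m$; its parameters are meant to satisfy $0 \le 2n \le m+1$, so that all
  double factorials below have arguments $\ge -1$.\<close>

definition p_poly :: "nat \<Rightarrow> int \<Rightarrow> real poly" where
  "p_poly n m = (\<Sum>j | j \<le> n \<and> even (n - j).
     monom ((-1) ^ ((n - j) div 2) *
       (fact n * of_int (double_fact (m - 2 * int n))) /
       (fact j * of_int (double_fact (m - int n - int j)) *
         of_int (double_fact (int (n - j))))) j)"

text \<open>Multi-indices $(\alpha_0,\dots,\alpha_d)$ are lists of length $d+1$, with $|\alpha|$ = \<open>sum_list \<alpha>\<close>,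
  $\alpha'$ = \<open>butlast \<alpha>\<close>, $\alpha_d$ = \<open>last \<alpha>\<close>. The last entry is the most significant one in the ordering.\<close>

inductive multi_index_less :: "nat list \<Rightarrow> nat list \<Rightarrow> bool" (infix "\<prec>" 50) where
  last_less: "length \<alpha> = length \<beta> \<Longrightarrow> a < b \<Longrightarrow> \<alpha> @ [a] \<prec> \<beta> @ [b]"
| last_eq: "\<alpha> \<prec> \<beta> \<Longrightarrow> \<alpha> @ [a] \<prec> \<beta> @ [a]"

lemma multi_index_less_length: "\<alpha> \<prec> \<beta> \<Longrightarrow> length \<alpha> = length \<beta>"
  by (induction rule: multi_index_less.induct) auto

lemma multi_index_less_Nil: "\<not> [] \<prec> []"
  by (auto elim: multi_index_less.cases)

lemma multi_index_less_snoc: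
  "length \<alpha> = length \<beta> \<Longrightarrow> \<alpha> @ [a] \<prec> \<beta> @ [b] \<longleftrightarrow> a < b \<or> (a = b \<and> \<alpha> \<prec> \<beta>)"
  by (auto intro: multi_index_less.intros elim: multi_index_less.cases)

text \<open>Points of $\mathbb{R}^k$ are functions \<open>nat \<Rightarrow> real\<close> of which only the coordinates below \<open>k\<close> matter
  (so $x'$ is again \<open>x\<close>), and polynomials in $x_0,\dots,x_{k-1}$ are represented by the functions they induce.\<close>

definition monomial_fun :: "nat list \<Rightarrow> (nat \<Rightarrow> real) \<Rightarrow> real" where
  "monomial_fun \<alpha> x = (\<Prod>i<length \<alpha>. x i ^ (\<alpha> ! i))"

definition gauss_form :: "nat \<Rightarrow> ((nat \<Rightarrow> real) \<Rightarrow> real) \<Rightarrow> ((nat \<Rightarrow> real) \<Rightarrow> real) \<Rightarrow> real" where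
  "gauss_form k f g =
     (2 * pi) powr (- (real k / 2)) *
     (\<integral>x. f x * g x * exp (- (1 / 2) * (\<Sum>i<k. (x i)\<^sup>2)) \<partial>(\<Pi>\<^sub>M i\<in>{..<k}. lborel))"

text \<open>For a polynomial $p$ of degree at most $n$ with $p(-t) = (-1)^n p(t)$, the polynomial
  $p(t/r)\,r^n$ after expansion, as a function of $t$ and $s = r^2$. It is also correct at $r = 0$.\<close>

definition homogenize :: "nat \<Rightarrow> real poly \<Rightarrow> real \<Rightarrow> real \<Rightarrow> real" where
  "homogenize n p t s = (\<Sum>j\<le>n. coeff p j * t ^ j * s ^ ((n - j) div 2))"

text \<open>The value at the empty multi-index is an irrelevant convention.\<close>

function h_fun :: "nat list \<Rightarrow> (nat \<Rightarrow> real) \<Rightarrow> real" where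
  "h_fun [] x = 1"
| "h_fun [a] x = x 0 ^ a"
| "\<alpha> \<noteq> [] \<Longrightarrow> h_fun (\<alpha> @ [a]) x =
     homogenize a (p_poly a (int (2 * sum_list (\<alpha> @ [a]) + length \<alpha>))) (x (length \<alpha>)) (\<Sum>i<length \<alpha>. (x i)\<^sup>2) *
     h_fun \<alpha> x"
  by (auto, metis append_self_conv2 rev_exhaust)
termination by (relation "Wellfounded.measure (\<lambda>(\<alpha>, x). length \<alpha>)") auto

lemma coeff_p_poly:
  "coeff (p_poly n m) j = (if j \<le> n \<and> even (n - j) then
     (-1) ^ ((n - j) div 2) * (fact n * of_int (double_fact (m - 2 * int n))) /
       (fact j * of_int (double_fact (m - int n - int j)) * of_int (double_fact (int (n - j)))) else 0)"
  by (auto simp: p_poly_def coeff_sum coeff_monom)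

lemma homogenize_p_poly:
  assumes "r \<noteq> 0"
  shows "homogenize n (p_poly n m) t (r\<^sup>2) = poly (p_poly n m) (t / r) * r ^ n"
proof -
  have "degree (p_poly n m) \<le> n"
    by (rule degree_le) (simp add: coeff_p_poly)
  then have "poly (p_poly n m) (t / r) = (\<Sum>j\<le>n. coeff (p_poly n m) j * (t / r) ^ j)"
    unfolding poly_altdef by (intro sum.mono_neutral_left) (auto simp: coeff_eq_0)
  moreover have "coeff (p_poly n m) j * t ^ j * (r\<^sup>2) ^ ((n - j) div 2) =
      coeff (p_poly n m) j * (t / r) ^ j * r ^ n" if "j \<le> n" for j
  proof (cases "even (n - j)")
    case True
    then have "(r\<^sup>2) ^ ((n - j) div 2) = r ^ (n - j)"
      by (simp flip: power_mult)
    moreover have "r ^ n = r ^ j * r ^ (n - j)"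
      using that by (simp flip: power_add)
    ultimately show ?thesis using assms by (simp add: power_divide)
  qed (simp add: coeff_p_poly)
  ultimately show ?thesis
    by (auto simp only: homogenize_def sum_distrib_right intro!: sum.cong)
qed

lemma h_fun_rec:
  assumes "length \<alpha> = d + 1" "d \<ge> 1"
    and r: "r = sqrt (\<Sum>i<d. (x i)\<^sup>2)" "r \<noteq> 0"
  shows "h_fun \<alpha> x =
    poly (p_poly (last \<alpha>) (int (2 * sum_list \<alpha> + d))) (x d / r) * r ^ last \<alpha> * h_fun (butlast \<alpha>) x"
proof -
  obtain \<gamma> a where \<alpha>: "\<alpha> = \<gamma> @ [a]" using assms(1) by (cases \<alpha> rule: rev_cases) auto
  have \<gamma>: "\<gamma> \<noteq> []" "length \<gamma> = d" using assms(1,2) \<alpha> by auto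
  have "r\<^sup>2 = (\<Sum>i<d. (x i)\<^sup>2)" using r(1) by (simp add: sum_nonneg)
  then show ?thesis
    using h_fun.simps(3)[OF \<gamma>(1), of a x] \<gamma>(2) \<alpha> homogenize_p_poly[OF r(2)] by simp
qed

end

theory Submission
  imports Defs "HOL-Probability.Distributions"
begin

text \<open>
  In polar form, $\langle\langle h_\alpha, h_\beta\rangle\rangle$ factors through the slope
  $u = x_d / r$: up to a constant it is $L_m(p_{\alpha_d}^m\, p_{\beta_d}^m)$ times
  $\langle\langle h_{\alpha'}, h_{\beta'}\rangle\rangle$, where $m = 2|\alpha| + d$ and $L_m$ is, up to
  a constant, integration against the weight $(1 + u^2)^{-(m+1)/2}$. The $p_n^m$ are the monic orthogonal
  polynomials of that weight (Romanovski polynomials): they satisfy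
  $(1 + u^2) p'' - (m - 1) u p' + n (m - n) p = 0$ and $(p_n^m)' = n\, p_{n-1}^{m-2}$, which together give
  $(m - n) L_m(u^l p_n^m) = l (m - 1) L_{m-2}(u^{l-1} p_{n-1}^{m-2})$, hence both the orthogonality
  and the norm. Polar coordinates are avoided by working with moments: $L_m$ is defined on monomials, and
  $r^2$ is removed from a Gaussian integral by
  $\langle\langle r^2, f\rangle\rangle = (\deg f + d) \langle\langle 1, f\rangle\rangle$ for homogeneous $f$
  in $d$ variables.
\<close>

section \<open>Romanovski polynomials\<close>

definition normal_moment :: "nat \<Rightarrow> real" where
  "normal_moment j = (\<integral>x. std_normal_density x * x ^ j \<partial>lborel)"

lemma normal_moment_0: "normal_moment 0 = 1"
  using has_bochner_integral_integral_eq[OF std_normal_moment_even[of 0]]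
  by (simp add: normal_moment_def)

lemma normal_moment_1: "normal_moment (Suc 0) = 0"
  using has_bochner_integral_integral_eq[OF std_normal_moment_odd[of 0]]
  by (simp add: normal_moment_def)

text \<open>Gaussian integration by parts, read off the closed form (2k)! / (2^k k!) of the even
  moments; odd moments vanish.\<close>

lemma normal_moment_Suc_Suc: "normal_moment (Suc (Suc j)) = real (Suc j) * normal_moment j"
proof (cases "even j")
  case True
  then obtain k where j: "j = 2 * k" by auto
  have "normal_moment (2 * i) = fact (2 * i) / (2 ^ i * fact i)" for i
    using has_bochner_integral_integral_eq[OF std_normal_moment_even[of i]]
    by (simp add: normal_moment_def)
  from this[of k] this[of "Suc k"]
  have "normal_moment j = fact j / (2 ^ k * fact k)"
    "normal_moment (Suc (Suc j)) = fact (Suc (Suc j)) / (2 ^ Suc k * fact (Suc k))"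
    unfolding j by simp_all
  moreover have "real (Suc (Suc j)) = 2 * real (Suc k)" by (simp add: j)
  ultimately show ?thesis
    by (simp only: fact_Suc power_Suc of_nat_mult) (simp add: divide_simps del: of_nat_Suc)
next
  case False
  then obtain k where j: "j = 2 * k + 1" by (auto elim: oddE)
  have "normal_moment (2 * i + 1) = 0" for i
    using has_bochner_integral_integral_eq[OF std_normal_moment_odd[of i]]
    by (simp add: normal_moment_def)
  from this[of k] this[of "Suc k"] show ?thesis by (simp add: j)
qed

abbreviation (input) rdf :: "int \<Rightarrow> real" where
  "rdf n \<equiv> real_of_int (double_fact n)"

lemma rdf_rec: "0 < n \<Longrightarrow> rdf n = of_int n * rdf (n - 2)"
  by (simp add: double_fact_rec)

lemma double_fact_pos: "0 < double_fact n"
  unfolding double_fact_def by (rule prod_pos) auto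

lemma double_fact_nonzero [simp]: "double_fact n \<noteq> 0"
  using double_fact_pos[of n] by simp

lemma rdf_nonzero: "rdf n \<noteq> 0"
  by simp

lemma fact_eq_rdf: "fact n = rdf (int n) * rdf (int n - 1)"
proof (induction n)
  case 0
  then show ?case by (simp add: double_fact_nonpos)
next
  case (Suc n)
  then show ?case using rdf_rec[of "int n + 1"] by (simp add: algebra_simps)
qed

text \<open>The factor \<open>normal_moment j\<close> comes from $x_d^j$, and the double factorial from the powers of $r$
  that accompany it.\<close>

definition romanovski_functional :: "int \<Rightarrow> real poly \<Rightarrow> real" where
  "romanovski_functional m p =
     (\<Sum>j\<le>degree p. coeff p j * (normal_moment j * rdf (m - int j - 2)))"

lemma romanovski_functional_altdef:
  assumes "degree p \<le> n"
  shows "romanovski_functional m p =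
    (\<Sum>j\<le>n. coeff p j * (normal_moment j * rdf (m - int j - 2)))"
  unfolding romanovski_functional_def using assms
  by (intro sum.mono_neutral_left) (auto simp: coeff_eq_0)

lemma romanovski_functional_add:
  "romanovski_functional m (p + q) = romanovski_functional m p + romanovski_functional m q"
proof -
  let ?n = "max (degree p) (degree q)"
  show ?thesis
    using romanovski_functional_altdef[of "p + q" ?n m] romanovski_functional_altdef[of p ?n m]
      romanovski_functional_altdef[of q ?n m] degree_add_le_max[of p q]
    by (simp add: algebra_simps sum.distrib)
qed

lemma romanovski_functional_smult:
  "romanovski_functional m (smult c p) = c * romanovski_functional m p"
  by (simp add: romanovski_functional_altdef[OF degree_smult_le] romanovski_functional_def
      sum_distrib_left mult.assoc)

lemma romanovski_functional_0 [simp]: "romanovski_functional m 0 = 0"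
  by (simp add: romanovski_functional_def)

lemma romanovski_functional_diff:
  "romanovski_functional m (p - q) = romanovski_functional m p - romanovski_functional m q"
  using romanovski_functional_add[of m "p - q" q] by simp

lemma romanovski_functional_sum:
  "romanovski_functional m (\<Sum>i\<in>I. p i) = (\<Sum>i\<in>I. romanovski_functional m (p i))"
  by (induction I rule: infinite_finite_induct) (auto simp: romanovski_functional_add)

lemma romanovski_functional_monom:
  "romanovski_functional m (monom c j) = c * (normal_moment j * rdf (m - int j - 2))"
proof -
  have "romanovski_functional m (monom c j) =
      (\<Sum>i\<le>j. if i = j then c * (normal_moment j * rdf (m - int j - 2)) else 0)"
    unfolding romanovski_functional_altdef[OF degree_monom_le] by (intro sum.cong) auto
  then show ?thesis by simp
qed

text \<open>The degree bound is kept only for monomials: there it makes the arguments of the double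
  factorials positive, so that \<open>rdf_rec\<close> applies, while linearity takes care of
  sums.\<close>

lemma poly_induct_bounded [consumes 1, case_names zero monom add]:
  assumes "degree p \<le> n" "P 0" "\<And>c j. j \<le> n \<Longrightarrow> P (monom c j)"
    "\<And>p q. P p \<Longrightarrow> P q \<Longrightarrow> P (p + q)"
  shows "P p"
proof -
  have "P (\<Sum>j\<in>S. monom (coeff p j) j)" if "finite S" "S \<subseteq> {..n}" for S
    using that by (induction S) (auto intro: assms(2-))
  from this[of "{..n}"] show ?thesis
    by (simp add: poly_as_sum_of_monoms'[OF assms(1)])
qed

lemma quad_mult_monom: "[:1, 0, 1:] * monom c j = monom (c::real) j + monom c (Suc (Suc j))"
  by (simp add: monom_Suc)

text \<open>Integration by parts for the weight $(1 + u^2)^{-(m+1)/2}$.\<close>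

lemma romanovski_functional_pderiv:
  assumes "degree f \<le> n" "int n + 1 < m"
  shows "romanovski_functional m ([:1, 0, 1:] * pderiv f) =
    of_int (m - 1) * romanovski_functional m (pCons 0 f)"
  using assms(1)
proof (induction rule: poly_induct_bounded)
  case zero
  then show ?case by simp
next
  case (monom c j)
  have rec: "rdf (m - int j - 1) = of_int (m - int j - 1) * rdf (m - int j - 3)"
    using rdf_rec[of "m - int j - 1"] monom assms(2) by simp
  have pc: "pCons 0 (monom c j) = monom c (Suc j)" by (simp add: monom_Suc)
  show ?case
  proof (cases j)
    \<comment> \<open>For constant f both sides vanish, the right one because the first moment is
      zero.\<close>
    case 0
    then show ?thesis
      unfolding pc romanovski_functional_monom
      by (simp add: normal_moment_1 pderiv_monom)
  next
    case (Suc i)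
    have eq: "m - int i - 2 = m - int j - 1" "m - int (Suc (Suc i)) - 2 = m - int j - 3"
      "m - int (Suc j) - 2 = m - int j - 3"
      by (simp_all add: Suc)
    have j: "real j = real i + 1" "j - 1 = i" by (simp_all add: Suc)
    \<comment> \<open>Both sides are multiples of
      \<open>normal_moment i * rdf (m - int j - 3)\<close>; on the left the factors (m - j - 1) + (i
      + 1) add up to m - 1.\<close>
    show ?thesis
      unfolding pc pderiv_monom quad_mult_monom romanovski_functional_add romanovski_functional_monom j eq rec
      unfolding Suc normal_moment_Suc_Suc
      by (simp add: of_int_diff) (simp only: algebra_simps)
  qed
next
  case (add p q)
  then show ?case
    using romanovski_functional_add[of m "pCons 0 p" "pCons 0 q"]
    by (simp only: pderiv_add distrib_left romanovski_functional_add add_pCons add_0_left)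
qed

text \<open>Multiplication by $1 + u^2$ turns the weight for $m$ into the one for $m - 2$.\<close>

lemma romanovski_functional_shift:
  assumes "degree f \<le> n" "int n + 2 < m"
  shows "romanovski_functional m ([:1, 0, 1:] * f) =
    of_int (m - 1) * romanovski_functional (m - 2) f"
  using assms(1)
proof (induction rule: poly_induct_bounded)
  case zero
  then show ?case by simp
next
  case (monom c j)
  have rec: "rdf (m - int j - 2) = of_int (m - int j - 2) * rdf (m - 2 - int j - 2)"
    using rdf_rec[of "m - int j - 2"] monom assms(2) by (simp add: algebra_simps)
  have eq: "m - int (Suc (Suc j)) - 2 = m - 2 - int j - 2" by simp
  \<comment> \<open>The two monomials contribute (m - j - 2) + (j + 1) = m - 1 times the same moment
    and double factorial.\<close>
  show ?case
    unfolding quad_mult_monom romanovski_functional_add romanovski_functional_monom normal_moment_Suc_Suc eq rec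
    by (simp add: of_int_diff) (simp only: algebra_simps)
next
  case (add p q)
  then show ?case
    by (simp only: distrib_left romanovski_functional_add)
qed

section \<open>The polynomials p_n^m: coefficients, derivative, differential equation\<close>

lemma coeff_p_poly_rec:
  assumes "2 * int n < m"
  shows "real (j + 2) * real (j + 1) * coeff (p_poly n m) (j + 2) =
    - ((real n - real j) * (of_int m - real n - real j) * coeff (p_poly n m) j)"
proof (cases "j + 2 \<le> n \<and> even (n - j)")
  case True
  then obtain i where i: "n = j + 2 + 2 * i"
  proof -
    from True have "even (n - (j + 2))" by auto
    then obtain i where "n - (j + 2) = 2 * i" by blast
    then have "n = j + 2 + 2 * i" using True by linarith
    then show ?thesis by (rule that)
  qed
  let ?u = "of_int m - real n - real j" and ?U = "rdf (m - int n - int j - 2)"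
    and ?V = "rdf (int (n - (j + 2)))" and ?N = "fact n * rdf (m - 2 * int n)"
  \<comment> \<open>Passing from j to j + 2 flips the sign and removes one factor from each double
    factorial: m - n - j from the first and n - j from the second.\<close>
  have u: "rdf (m - int n - int j) = ?u * ?U"
    using rdf_rec[of "m - int n - int j"] assms True by simp
  have v: "rdf (int (n - j)) = (real n - real j) * ?V"
    using rdf_rec[of "int (n - j)"] by (simp add: i algebra_simps)
  have eqs: "m - int n - int (j + 2) = m - int n - int j - 2"
    "(n - j) div 2 = Suc i" "(n - (j + 2)) div 2 = i"
    "(j \<le> n \<and> even (n - j)) = True" "(j + 2 \<le> n \<and> even (n - (j + 2))) = True"
    by (simp_all add: i)
  have coeffs: "coeff (p_poly n m) j = (-1) ^ Suc i * ?N / (fact j * (?u * ?U) * ((real n - real j) * ?V))"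
    "coeff (p_poly n m) (j + 2) = (-1) ^ i * ?N / (fact (j + 2) * ?U * ?V)"
    unfolding coeff_p_poly eqs u v if_True by (rule refl)+
  have fact: "fact (j + 2) = real (j + 2) * real (j + 1) * fact j"
    by (simp add: algebra_simps)
  have "?u \<noteq> 0" "real n - real j \<noteq> 0"
    using assms True by auto
  then show ?thesis
    unfolding coeffs fact by (simp add: divide_simps del: of_nat_add)
next
  case False
  \<comment> \<open>In the remaining cases every coefficient involved is zero, unless j = n, where
    the factor n - j vanishes and j + 2 exceeds the degree.\<close>
  then have "j > n \<or> j = n \<or> odd (n - j) \<and> j < n" by presburger
  then consider "j > n" | "j = n" | "odd (n - j)" "j < n" by blast
  then show ?thesis
    by cases (auto simp: coeff_p_poly)
qed

text \<open>The factor j + 1 from differentiation cancels in (j + 1)!, and replacing (n, m) by (n -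
  1, m - 2) compensates the index shift in every double factorial.\<close>

lemma pderiv_p_poly:
  assumes "n > 0"
  shows "pderiv (p_poly n m) = smult (real n) (p_poly (n - 1) (m - 2))"
proof (rule poly_eqI)
  fix j
  obtain k where n: "n = Suc k" using assms by (cases n) auto
  have eqs: "m - int (Suc k) - int (Suc j) = m - 2 - int k - int j"
    "m - 2 * int (Suc k) = m - 2 - 2 * int k" "Suc k - Suc j = k - j" "Suc k - 1 = k"
    "Suc j \<le> Suc k \<longleftrightarrow> j \<le> k"
    by simp_all
  show "coeff (pderiv (p_poly n m)) j = coeff (smult (real n) (p_poly (n - 1) (m - 2))) j"
    unfolding n coeff_pderiv coeff_smult coeff_p_poly fact_Suc eqs
    by (cases "j \<le> k \<and> even (k - j)") (simp_all add: divide_simps del: of_nat_Suc of_nat_diff)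
qed

lemma coeff_quad_mult:
  "coeff ([:1, 0, 1:] * (q :: real poly)) j = coeff q j + (if j \<ge> 2 then coeff q (j - 2) else 0)"
  by (auto simp: coeff_pCons split: nat.splits)

text \<open>Comparing coefficients of u^j gives \<open>coeff_p_poly_rec\<close>, because n (m - n) -
  (m - 1) j + j (j - 1) = (n - j) (m - n - j).\<close>

lemma p_poly_ode:
  assumes "2 * int n < m"
  shows "[:1, 0, 1:] * pderiv (pderiv (p_poly n m)) =
    smult (of_int (m - 1)) (pCons 0 (pderiv (p_poly n m))) -
    smult (real n * (of_int m - real n)) (p_poly n m)"
proof (rule poly_eqI)
  fix j
  have "real (j + 2) * real (j + 1) * coeff (p_poly n m) (j + 2) =
    - ((real n - real j) * (of_int m - real n - real j) * coeff (p_poly n m) j)"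
    by (rule coeff_p_poly_rec[OF assms])
  then show "coeff ([:1, 0, 1:] * pderiv (pderiv (p_poly n m))) j =
    coeff (smult (of_int (m - 1)) (pCons 0 (pderiv (p_poly n m))) -
      smult (real n * (of_int m - real n)) (p_poly n m)) j"
    unfolding coeff_quad_mult
    by (cases j; cases "j - 1") (auto simp: coeff_pderiv algebra_simps)
qed

section \<open>Orthogonality and norm of p_n^m under the functional\<close>

lemma degree_p_poly: "degree (p_poly n m) \<le> n"
  by (rule degree_le) (simp add: coeff_p_poly)

text \<open>Apply the functional to u^l times the differential equation and integrate u^l p' by
  parts. The terms (m - 1) u^(l+1) p' cancel; the leftover l (1 + u^2) u^(l-1) p' drops the
  parameter to m - 2 and, by \<open>pderiv_p_poly\<close>, the index to n - 1.\<close>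

lemma romanovski_functional_p_poly_rec:
  assumes "n > 0" "l \<le> n" "2 * int n < m"
  shows "(of_int m - real n) * romanovski_functional m (monom 1 l * p_poly n m) =
    real l * of_int (m - 1) * romanovski_functional (m - 2) (monom 1 (l - 1) * p_poly (n - 1) (m - 2))"
proof -
  let ?L = "romanovski_functional" and ?p = "p_poly n m" and ?p' = "pderiv (p_poly n m)"
  have deg: "degree (monom 1 i * ?p') \<le> i + (n - 1)" for i
    using degree_mult_le[of "monom 1 i" ?p'] degree_monom_le[of "1::real" i] degree_p_poly[of n m]
    by (simp add: degree_pderiv)
  have deg': "degree (monom 1 i * p_poly (n - 1) (m - 2)) \<le> i + (n - 1)" for i
    using degree_mult_le[of "monom 1 i" "p_poly (n - 1) (m - 2)"] degree_monom_le[of "1::real" i]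
      degree_p_poly[of "n - 1" "m - 2"]
    by linarith
  have split: "monom 1 l * ([:1, 0, 1:] * pderiv ?p') =
      [:1, 0, 1:] * pderiv (monom 1 l * ?p') -
      smult (real l) ([:1, 0, 1:] * (monom 1 (l - 1) * ?p'))"
  proof -
    have "pderiv (monom 1 l) = smult (real l) (monom 1 (l - 1))"
      by (simp add: pderiv_monom smult_monom)
    then show ?thesis
      by (simp only: pderiv_mult distrib_left mult_smult_left mult_smult_right
          mult.left_commute[of "monom 1 l"] mult.left_commute[of ?p'] mult.commute[of ?p'])
  qed
  have "?L m (monom 1 l * ([:1, 0, 1:] * pderiv ?p')) =
      of_int (m - 1) * ?L m (pCons 0 (monom 1 l * ?p')) -
      real l * ?L m ([:1, 0, 1:] * (monom 1 (l - 1) * ?p'))"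
    unfolding split romanovski_functional_diff romanovski_functional_smult
    using romanovski_functional_pderiv[OF deg, of l m] assms by auto
  moreover have "real l * ?L m ([:1, 0, 1:] * (monom 1 (l - 1) * ?p')) =
      real l * (of_int (m - 1) * (real n * ?L (m - 2) (monom 1 (l - 1) * p_poly (n - 1) (m - 2))))"
  \<comment> \<open>With l = 0 the truncated exponent l - 1 is harmless, since both sides carry the
    factor l.\<close>
  proof (cases "l = 0")
    case False
    then show ?thesis
      using romanovski_functional_shift[OF deg', of "l - 1" m] assms
      by (simp only: pderiv_p_poly[OF assms(1)] mult_smult_right romanovski_functional_smult) auto
  qed simp
  moreover have "?L m (monom 1 l * ([:1, 0, 1:] * pderiv ?p')) =
      of_int (m - 1) * ?L m (pCons 0 (monom 1 l * ?p')) -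
      real n * (of_int m - real n) * ?L m (monom 1 l * ?p)"
    unfolding p_poly_ode[OF assms(3)]
    by (simp only: right_diff_distrib romanovski_functional_diff romanovski_functional_smult
        mult_smult_right mult_pCons_right smult_0_left add_0_left)
  ultimately have "real n * ((of_int m - real n) * ?L m (monom 1 l * ?p)) =
     real n * (real l * of_int (m - 1) * ?L (m - 2) (monom 1 (l - 1) * p_poly (n - 1) (m - 2)))"
    by (simp add: algebra_simps)
  then show ?thesis using assms(1) by simp
qed

text \<open>The recursion lowers (l, n, m) to (l - 1, n - 1, m - 2) until l = 0, where its factor l
  annihilates the right-hand side; m - n stays nonzero because 2n < m.\<close>

lemma romanovski_functional_p_poly_orthogonal:
  assumes "l < n" "2 * int n < m"
  shows "romanovski_functional m (monom 1 l * p_poly n m) = 0"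
  using assms
proof (induction n arbitrary: l m)
  case (Suc n)
  have "romanovski_functional (m - 2) (monom 1 (l - 1) * p_poly n (m - 2)) = 0" if "l > 0"
    by (rule Suc.IH) (use Suc.prems that in auto)
  then have "(of_int m - real (Suc n)) * romanovski_functional m (monom 1 l * p_poly (Suc n) m) = 0"
    using romanovski_functional_p_poly_rec[of "Suc n" l m] Suc.prems by auto
  moreover have "real_of_int m - real (Suc n) \<noteq> 0" using Suc.prems by simp
  ultimately show ?case by simp
qed simp

text \<open>Writing m = M + 2n makes M invariant under the passage from (n, m) to (n - 1, m - 2);
  each step of the recursion contributes n (m - 1) / (m - n), with m - n = M + n.\<close>

lemma romanovski_functional_p_poly_norm:
  assumes "M > 0"
  shows "romanovski_functional (int M + 2 * int n) (monom 1 n * p_poly n (int M + 2 * int n)) =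
    fact n * rdf (int M) * rdf (int M - 2) * rdf (int M + 2 * int n - 1) / fact (M + n)"
proof (induction n)
  case 0
  have "p_poly 0 (int M) = 1"
    by (rule poly_eqI) (auto simp: coeff_p_poly double_fact_nonpos)
  \<comment> \<open>The functional takes the value (M - 2)!! at 1, and M! = M!! (M - 1)!! cancels
    the other factors.\<close>
  then show ?case
    using romanovski_functional_monom[of "int M" 1 0] fact_eq_rdf[of M]
    by (simp add: normal_moment_0 field_simps)
next
  case (Suc n)
  let ?m = "int M + 2 * int (Suc n)"
  have m: "?m - 2 = int M + 2 * int n" by simp
  have r: "rdf (?m - 1) = of_int (?m - 1) * rdf (int M + 2 * int n - 1)"
    using rdf_rec[of "?m - 1"] by (simp add: algebra_simps)
  have "(of_int ?m - real (Suc n)) * romanovski_functional ?m (monom 1 (Suc n) * p_poly (Suc n) ?m)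
    = real (Suc n) * of_int (?m - 1) * romanovski_functional (?m - 2) (monom 1 n * p_poly n (?m - 2))"
    using romanovski_functional_p_poly_rec[of "Suc n" "Suc n" ?m] assms by simp
  also have "of_int ?m - real (Suc n) = real (M + Suc n)" by simp
  finally have "romanovski_functional ?m (monom 1 (Suc n) * p_poly (Suc n) ?m) =
    real (Suc n) * of_int (?m - 1) * romanovski_functional (?m - 2) (monom 1 n * p_poly n (?m - 2)) /
      real (M + Suc n)"
    by (simp add: field_simps)
  also have "\<dots> = fact (Suc n) * rdf (int M) * rdf (int M - 2) * rdf (?m - 1) / fact (M + Suc n)"
    unfolding m Suc.IH r by (simp add: divide_simps)
  finally show ?case .
qed

text \<open>Expanding q in monomials, orthogonality leaves only u^n. So q of lower degree gives
  zero, and a monic q of degree n may be replaced by u^n.\<close>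

lemma romanovski_functional_mult_p_poly:
  assumes "degree q \<le> n" "2 * int n < m"
  shows "romanovski_functional m (q * p_poly n m) =
    coeff q n * romanovski_functional m (monom 1 n * p_poly n m)"
proof -
  have "q * p_poly n m = (\<Sum>j\<le>n. smult (coeff q j) (monom 1 j * p_poly n m))"
    using poly_as_sum_of_monoms'[of q n] assms
    by (simp add: sum_distrib_right[symmetric] smult_monom flip: mult_smult_left)
  then have "romanovski_functional m (q * p_poly n m) =
      (\<Sum>j\<le>n. coeff q j * romanovski_functional m (monom 1 j * p_poly n m))"
    by (simp add: romanovski_functional_sum romanovski_functional_smult)
  also have "\<dots> = (\<Sum>j\<in>{n}. coeff q j * romanovski_functional m (monom 1 j * p_poly n m))"
    by (rule sum.mono_neutral_right) (use assms romanovski_functional_p_poly_orthogonal[of _ n m] in auto)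
  finally show ?thesis by simp
qed

lemma coeff_p_poly_self: "coeff (p_poly n m) n = 1"
  by (simp add: coeff_p_poly double_fact_nonpos)

section \<open>Gaussian integrals of homogeneous polynomials\<close>

text \<open>Built up one monomial at a time, so that linear identities for Gaussian integrals reduce
  to monomials by rule induction. The zero function counts as homogeneous of every degree.\<close>

inductive hom_poly :: "nat \<Rightarrow> nat \<Rightarrow> ((nat \<Rightarrow> real) \<Rightarrow> real) \<Rightarrow> bool" for k D where
  hom_poly_zero: "hom_poly k D (\<lambda>_. 0)"
| hom_poly_add_monom: "hom_poly k D f \<Longrightarrow> (\<Sum>i<k. \<gamma> i) = D \<Longrightarrow>
    hom_poly k D (\<lambda>x. f x + c * (\<Prod>i<k. x i ^ \<gamma> i))"

lemma hom_poly_monom: "(\<Sum>i<k. \<gamma> i) = D \<Longrightarrow> hom_poly k D (\<lambda>x. c * (\<Prod>i<k. x i ^ \<gamma> i))"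
  using hom_poly_add_monom[OF hom_poly_zero, where c = c] by fastforce

lemma hom_poly_add: "hom_poly k D f \<Longrightarrow> hom_poly k D g \<Longrightarrow> hom_poly k D (\<lambda>x. f x + g x)"
proof (induction rule: hom_poly.induct)
  case (hom_poly_add_monom f \<gamma> c)
  then show ?case
    using hom_poly.hom_poly_add_monom[of k D "\<lambda>x. f x + g x" \<gamma> c] by (simp add: add_ac)
qed simp

lemma hom_poly_sum:
  "(\<And>i. i \<in> I \<Longrightarrow> hom_poly k D (f i)) \<Longrightarrow> hom_poly k D (\<lambda>x. \<Sum>i\<in>I. f i x)"
  by (induction I rule: infinite_finite_induct) (auto intro: hom_poly_zero hom_poly_add)

lemma hom_poly_mult_monom:
  assumes "hom_poly k D f" "(\<Sum>i<k. \<gamma> i) = D'"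
  shows "hom_poly k (D + D') (\<lambda>x. f x * (c * (\<Prod>i<k. x i ^ \<gamma> i)))"
  using assms(1)
proof (induction rule: hom_poly.induct)
  case hom_poly_zero
  then show ?case by (simp add: hom_poly.hom_poly_zero)
next
  case (hom_poly_add_monom f \<delta> b)
  have "hom_poly k (D + D') (\<lambda>x. f x * (c * (\<Prod>i<k. x i ^ \<gamma> i)) +
      (b * c) * (\<Prod>i<k. x i ^ (\<delta> i + \<gamma> i)))"
    by (rule hom_poly.hom_poly_add_monom)
       (use hom_poly_add_monom assms(2) in \<open>auto simp: sum.distrib\<close>)
  then show ?case by (simp add: algebra_simps power_add prod.distrib)
qed

lemma hom_poly_mult:
  assumes "hom_poly k D f" "hom_poly k D' g"
  shows "hom_poly k (D + D') (\<lambda>x. f x * g x)"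
  using assms(2)
proof (induction rule: hom_poly.induct)
  case hom_poly_zero
  then show ?case by (simp add: hom_poly.hom_poly_zero)
next
  case (hom_poly_add_monom g \<gamma> c)
  then show ?case
    using hom_poly_add hom_poly_mult_monom[OF assms(1)] by (simp add: distrib_left)
qed

lemma hom_poly_const: "hom_poly k 0 (\<lambda>_. c)"
  using hom_poly_monom[where k = k and \<gamma> = "\<lambda>_. 0" and c = c] by simp

lemma hom_poly_cmult: "hom_poly k D f \<Longrightarrow> hom_poly k D (\<lambda>x. c * f x)"
  using hom_poly_mult[OF hom_poly_const] by fastforce

lemma hom_poly_coord:
  assumes "i < k"
  shows "hom_poly k n (\<lambda>x. x i ^ n)"
proof -
  have "(\<Prod>j<k. x j ^ (if j = i then n else 0)) = x i ^ n" for x :: "nat \<Rightarrow> real"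
    using assms by (simp add: if_distrib[of "power _"] cong: if_cong)
  then show ?thesis
    using hom_poly_monom[where k = k and \<gamma> = "\<lambda>j. if j = i then n else 0" and c = 1] assms by simp
qed

lemma hom_poly_power: "hom_poly k D f \<Longrightarrow> hom_poly k (i * D) (\<lambda>x. f x ^ i)"
  by (induction i) (auto intro: hom_poly_const hom_poly_mult)

lemma hom_poly_norm_power: "j \<le> k \<Longrightarrow> hom_poly k (2 * i) (\<lambda>x. (\<Sum>l<j. (x l)\<^sup>2) ^ i)"
  using hom_poly_power[OF hom_poly_sum, of "{..<j}" k 2 "\<lambda>l x. (x l)\<^sup>2" i] hom_poly_coord[of _ k 2]
  by (auto simp: mult.commute)

lemma hom_poly_Suc:
  assumes "hom_poly k D f"
  shows "hom_poly (Suc k) (j + D) (\<lambda>x. x k ^ j * f x)"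
  using assms
proof (induction rule: hom_poly.induct)
  case hom_poly_zero
  then show ?case by (simp add: hom_poly.hom_poly_zero)
next
  case (hom_poly_add_monom f \<gamma> c)
  have "hom_poly (Suc k) (j + D)
      (\<lambda>x. x k ^ j * f x + c * (\<Prod>i<Suc k. x i ^ (\<gamma>(k := j)) i))"
    by (rule hom_poly.hom_poly_add_monom) (use hom_poly_add_monom in auto)
  then show ?case by (simp add: algebra_simps)
qed

text \<open>The parity condition makes the halving of n - j exact, so each nonzero summand has
  degree j + 2 ((n - j) div 2) + D = n + D.\<close>

lemma hom_poly_homogenize:
  assumes "\<And>j. coeff p j \<noteq> 0 \<Longrightarrow> even (n - j)" "hom_poly k D f"
  shows "hom_poly (Suc k) (n + D) (\<lambda>x. homogenize n p (x k) (\<Sum>i<k. (x i)\<^sup>2) * f x)"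
proof -
  have "hom_poly (Suc k) (n + D)
      (\<lambda>x. coeff p j * (x k ^ j * ((\<Sum>i<k. (x i)\<^sup>2) ^ ((n - j) div 2) * f x)))"
    if "j \<le> n" for j
  proof (cases "coeff p j = 0")
    case False
    then have eq: "n + D = j + (2 * ((n - j) div 2) + D)" using assms(1)[of j] that by simp
    show ?thesis
      by (subst eq) (rule hom_poly_cmult[OF hom_poly_Suc[where j = j, OF hom_poly_mult[OF
            hom_poly_norm_power[OF order_refl, of k "(n - j) div 2"] assms(2)]]])
  qed (simp add: hom_poly_zero)
  then have "hom_poly (Suc k) (n + D)
      (\<lambda>x. \<Sum>j\<le>n. coeff p j * (x k ^ j * ((\<Sum>i<k. (x i)\<^sup>2) ^ ((n - j) div 2) * f x)))"
    by (intro hom_poly_sum) auto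
  then show ?thesis
    unfolding homogenize_def sum_distrib_right by (simp only: mult.assoc)
qed

lemma even_if_coeff_p_poly_nonzero: "coeff (p_poly n m) j \<noteq> 0 \<Longrightarrow> even (n - j)"
  by (simp add: coeff_p_poly split: if_splits)

lemma hom_poly_h_fun: "hom_poly (length \<alpha>) (sum_list \<alpha>) (h_fun \<alpha>)"
proof (induction \<alpha> rule: rev_induct)
  case Nil
  then show ?case using hom_poly_const by (simp add: fun_eq_iff[of "h_fun []"])
next
  case (snoc a \<alpha>)
  show ?case
  proof (cases "\<alpha> = []")
    case True
    moreover have "h_fun [a] = (\<lambda>x. x 0 ^ a)" by auto
    ultimately show ?thesis using hom_poly_coord[of 0 1 a] by simp
  next
    case False
    have "hom_poly (Suc (length \<alpha>)) (a + sum_list \<alpha>) (h_fun (\<alpha> @ [a]))"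
      unfolding h_fun.simps(3)[OF False, abs_def]
      by (rule hom_poly_homogenize[OF even_if_coeff_p_poly_nonzero snoc.IH])
    then show ?thesis by (simp add: add.commute)
  qed
qed

lemma hom_poly_monomial_fun: "hom_poly (length \<alpha>) (sum_list \<alpha>) (monomial_fun \<alpha>)"
  using hom_poly_monom[where k = "length \<alpha>" and \<gamma> = "\<lambda>i. \<alpha> ! i" and c = 1]
  by (simp add: monomial_fun_def[abs_def] sum_list_sum_nth atLeast0LessThan)

section \<open>Gaussian expectations and the removal of powers of r\<close>

definition gauss_integrable :: "nat \<Rightarrow> ((nat \<Rightarrow> real) \<Rightarrow> real) \<Rightarrow> bool" where
  "gauss_integrable k f \<longleftrightarrow>
     integrable (\<Pi>\<^sub>M i\<in>{..<k}. lborel) (\<lambda>x. f x * (\<Prod>i<k. std_normal_density (x i)))"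

definition gauss_expectation :: "nat \<Rightarrow> ((nat \<Rightarrow> real) \<Rightarrow> real) \<Rightarrow> real" where
  "gauss_expectation k f =
     (\<integral>x. f x * (\<Prod>i<k. std_normal_density (x i)) \<partial>(\<Pi>\<^sub>M i\<in>{..<k}. lborel))"

text \<open>The constant (2 pi)^(-k/2) is distributed over the k coordinates as 1 / sqrt (2 pi),
  which turns the weight into a product of one-dimensional densities.\<close>

lemma gauss_form_eq_expectation: "gauss_form k f g = gauss_expectation k (\<lambda>x. f x * g x)"
proof -
  have "sqrt (2 * pi) ^ k = (2 * pi) powr (real k / 2)"
    using powr_power[of "2 * pi" "1 / 2" k] by (simp add: powr_half_sqrt)
  then have const: "(1 / sqrt (2 * pi)) ^ k = (2 * pi) powr (- (real k / 2))"
    by (simp only: power_one_over powr_minus_divide)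
  have "(\<Prod>i<k. exp (- (x i)\<^sup>2 / 2)) = exp (- (1 / 2) * (\<Sum>i<k. (x i)\<^sup>2))"
    for x :: "nat \<Rightarrow> real"
    unfolding sum_distrib_left by (simp add: exp_sum)
  then have "(\<Prod>i<k. std_normal_density (x i)) =
      (2 * pi) powr (- (real k / 2)) * exp (- (1 / 2) * (\<Sum>i<k. (x i)\<^sup>2))"
    for x :: "nat \<Rightarrow> real"
    unfolding std_normal_density_def prod.distrib prod_constant card_lessThan const by simp
  then show ?thesis
    unfolding gauss_form_def gauss_expectation_def integral_mult_right_zero[symmetric]
    by (simp only: mult.left_commute mult.assoc)
qed

interpretation lborel_product: product_sigma_finite "\<lambda>_. lborel :: real measure"
  by standard

text \<open>Monomial and density both factor over the coordinates, so the product measure reduces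
  everything to one-dimensional moments.\<close>

lemma
  shows gauss_integrable_monom: "gauss_integrable k (\<lambda>x. \<Prod>i<k. x i ^ \<gamma> i)"
    and gauss_expectation_monom:
      "gauss_expectation k (\<lambda>x. \<Prod>i<k. x i ^ \<gamma> i) = (\<Prod>i<k. normal_moment (\<gamma> i))"
proof -
  have "(\<Prod>i<k. x i ^ \<gamma> i) * (\<Prod>i<k. std_normal_density (x i)) =
      (\<Prod>i<k. std_normal_density (x i) * x i ^ \<gamma> i)" for x :: "nat \<Rightarrow> real"
    by (simp add: prod.distrib mult.commute)
  then show "gauss_integrable k (\<lambda>x. \<Prod>i<k. x i ^ \<gamma> i)"
    "gauss_expectation k (\<lambda>x. \<Prod>i<k. x i ^ \<gamma> i) = (\<Prod>i<k. normal_moment (\<gamma> i))"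
    unfolding gauss_integrable_def gauss_expectation_def normal_moment_def
    using lborel_product.product_integrable_prod[of "{..<k}" "\<lambda>i x. std_normal_density x * x ^ \<gamma> i"]
      lborel_product.product_integral_prod[of "{..<k}" "\<lambda>i x. std_normal_density x * x ^ \<gamma> i"]
      integrable_std_normal_moment
    by simp_all
qed

lemma gauss_integrable_add:
  "gauss_integrable k f \<Longrightarrow> gauss_integrable k g \<Longrightarrow> gauss_integrable k (\<lambda>x. f x + g x)"
  by (simp add: gauss_integrable_def distrib_right)

lemma gauss_integrable_cmult: "gauss_integrable k f \<Longrightarrow> gauss_integrable k (\<lambda>x. c * f x)"
  by (simp add: gauss_integrable_def mult.assoc)

lemma gauss_expectation_add:
  "gauss_integrable k f \<Longrightarrow> gauss_integrable k g \<Longrightarrow>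
    gauss_expectation k (\<lambda>x. f x + g x) = gauss_expectation k f + gauss_expectation k g"
  by (simp add: gauss_integrable_def gauss_expectation_def distrib_right)

lemma gauss_expectation_cmult:
  "gauss_expectation k (\<lambda>x. c * f x) = c * gauss_expectation k f"
  by (simp add: gauss_expectation_def mult.assoc)

lemma gauss_integrable_sum:
  "(\<And>i. i \<in> I \<Longrightarrow> gauss_integrable k (f i)) \<Longrightarrow> gauss_integrable k (\<lambda>x. \<Sum>i\<in>I. f i x)"
  by (simp add: gauss_integrable_def sum_distrib_right)

lemma gauss_expectation_sum:
  "(\<And>i. i \<in> I \<Longrightarrow> gauss_integrable k (f i)) \<Longrightarrow>
    gauss_expectation k (\<lambda>x. \<Sum>i\<in>I. f i x) = (\<Sum>i\<in>I. gauss_expectation k (f i))"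
  by (simp add: gauss_integrable_def gauss_expectation_def sum_distrib_right)

lemma gauss_expectation_zero: "gauss_expectation k (\<lambda>_. 0) = 0"
  by (simp add: gauss_expectation_def)

lemma gauss_integrable_hom_poly: "hom_poly k D f \<Longrightarrow> gauss_integrable k f"
proof (induction rule: hom_poly.induct)
  case hom_poly_zero
  then show ?case by (simp add: gauss_integrable_def)
next
  case (hom_poly_add_monom f \<gamma> c)
  then show ?case by (intro gauss_integrable_add gauss_integrable_cmult gauss_integrable_monom)
qed

text \<open>Multiplying by x_i^2 raises gamma_i by 2 and so multiplies the expectation by gamma_i +
  1; summing over i < k gives |gamma| + k.\<close>

lemma gauss_expectation_norm_monom:
  "gauss_expectation k (\<lambda>x. (\<Sum>i<k. (x i)\<^sup>2) * (\<Prod>i<k. x i ^ \<gamma> i)) =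
    real ((\<Sum>i<k. \<gamma> i) + k) * gauss_expectation k (\<lambda>x. \<Prod>i<k. x i ^ \<gamma> i)"
proof -
  \<comment> \<open>\<open>F\<close> is instantiated both with powers of coordinates and with normal
    moments.\<close>
  have prod_upd: "(\<Prod>j<k. F j ((\<gamma>(i := \<gamma> i + 2)) j)) =
      F i (\<gamma> i + 2) * (\<Prod>j\<in>{..<k} - {i}. F j (\<gamma> j))"
    if "i < k" for i and F :: "nat \<Rightarrow> nat \<Rightarrow> real"
    using that by (subst prod.remove[of _ i]) (auto intro!: prod.cong)
  have split: "(\<Prod>j<k. F j (\<gamma> j)) = F i (\<gamma> i) * (\<Prod>j\<in>{..<k} - {i}. F j (\<gamma> j))"
    if "i < k" for i and F :: "nat \<Rightarrow> nat \<Rightarrow> real"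
    using that by (subst prod.remove[of _ i]) auto
  have "(\<Sum>i<k. (x i)\<^sup>2) * (\<Prod>i<k. x i ^ \<gamma> i) =
      (\<Sum>i<k. \<Prod>j<k. x j ^ (\<gamma>(i := \<gamma> i + 2)) j)" for x :: "nat \<Rightarrow> real"
    unfolding sum_distrib_right
  proof (rule sum.cong)
    fix i assume "i \<in> {..<k}"
    then have "i < k" by simp
    show "(x i)\<^sup>2 * (\<Prod>i<k. x i ^ \<gamma> i) = (\<Prod>j<k. x j ^ (\<gamma>(i := \<gamma> i + 2)) j)"
      using prod_upd[OF \<open>i < k\<close>, of "\<lambda>j. power (x j)"] split[OF \<open>i < k\<close>, of "\<lambda>j. power (x j)"]
      by (simp add: power2_eq_square mult_ac)
  qed simp
  then have "gauss_expectation k (\<lambda>x. (\<Sum>i<k. (x i)\<^sup>2) * (\<Prod>i<k. x i ^ \<gamma> i)) =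
      (\<Sum>i<k. gauss_expectation k (\<lambda>x. \<Prod>j<k. x j ^ (\<gamma>(i := \<gamma> i + 2)) j))"
    by (simp only: gauss_expectation_sum[OF gauss_integrable_monom])
  also have "\<dots> = (\<Sum>i<k. real (Suc (\<gamma> i)) * (\<Prod>j<k. normal_moment (\<gamma> j)))"
    unfolding gauss_expectation_monom
  proof (rule sum.cong)
    fix i assume "i \<in> {..<k}"
    then have "i < k" by simp
    show "(\<Prod>j<k. normal_moment ((\<gamma>(i := \<gamma> i + 2)) j)) =
        real (Suc (\<gamma> i)) * (\<Prod>j<k. normal_moment (\<gamma> j))"
      using prod_upd[OF \<open>i < k\<close>, of "\<lambda>_. normal_moment"] split[OF \<open>i < k\<close>, of "\<lambda>_. normal_moment"]
      by (simp add: normal_moment_Suc_Suc)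
  qed simp
  also have "\<dots> = real ((\<Sum>i<k. \<gamma> i) + k) * (\<Prod>j<k. normal_moment (\<gamma> j))"
    by (simp add: sum_distrib_right[symmetric] sum.distrib add.commute)
  finally show ?thesis by (simp only: gauss_expectation_monom)
qed

text \<open>Both sides are linear in f, and homogeneity makes the factor D + k the same for all
  monomials.\<close>

lemma gauss_expectation_norm_mult:
  assumes "hom_poly k D f"
  shows "gauss_expectation k (\<lambda>x. (\<Sum>i<k. (x i)\<^sup>2) * f x) = real (D + k) * gauss_expectation k f"
  using assms
proof (induction rule: hom_poly.induct)
  case hom_poly_zero
  then show ?case by (simp add: gauss_expectation_zero)
next
  case (hom_poly_add_monom f \<gamma> c)
  let ?M = "\<lambda>x :: nat \<Rightarrow> real. \<Prod>i<k. x i ^ \<gamma> i" and ?s = "\<lambda>x :: nat \<Rightarrow> real. \<Sum>i<k. (x i)\<^sup>2"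
  have int: "gauss_integrable k g" "gauss_integrable k (\<lambda>x. ?s x * g x)" if "hom_poly k D g" for g
    using gauss_integrable_hom_poly[OF that]
      gauss_integrable_hom_poly[OF hom_poly_mult[OF hom_poly_norm_power that], of k 1] by simp_all
  have M: "hom_poly k D ?M" using hom_poly_monom[OF hom_poly_add_monom(2), of 1] by simp
  have "gauss_expectation k (\<lambda>x. ?s x * (f x + c * ?M x)) =
      gauss_expectation k (\<lambda>x. ?s x * f x + c * (?s x * ?M x))"
    by (simp add: algebra_simps)
  also have "\<dots> = gauss_expectation k (\<lambda>x. ?s x * f x) + c * gauss_expectation k (\<lambda>x. ?s x * ?M x)"
    by (subst gauss_expectation_add)
       (use int[OF hom_poly_add_monom(1)] int[OF M] in
         \<open>auto intro: gauss_integrable_cmult simp: gauss_expectation_cmult\<close>)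
  also have "\<dots> = real (D + k) * (gauss_expectation k f + c * gauss_expectation k ?M)"
    unfolding gauss_expectation_norm_monom hom_poly_add_monom by (simp add: distrib_left)
  also have "gauss_expectation k f + c * gauss_expectation k ?M =
      gauss_expectation k (\<lambda>x. f x + c * ?M x)"
    by (subst gauss_expectation_add)
       (use int[OF hom_poly_add_monom(1)] int[OF M] in
         \<open>auto intro: gauss_integrable_cmult simp: gauss_expectation_cmult\<close>)
  finally show ?case .
qed

text \<open>Each factor r^2 raises the degree by 2, so removing n of them yields (D + k) (D + k + 2)
  ... (D + k + 2n - 2), a quotient of double factorials, stated here without division.\<close>

lemma gauss_expectation_norm_power_mult:
  assumes "hom_poly k D f" "D + k > 0"
  shows "gauss_expectation k (\<lambda>x. (\<Sum>i<k. (x i)\<^sup>2) ^ n * f x) * rdf (int (D + k) - 2) =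
    rdf (int (D + k + 2 * n) - 2) * gauss_expectation k f"
proof (induction n)
  case (Suc n)
  have "gauss_expectation k (\<lambda>x. (\<Sum>i<k. (x i)\<^sup>2) ^ Suc n * f x) =
      real (D + k + 2 * n) * gauss_expectation k (\<lambda>x. (\<Sum>i<k. (x i)\<^sup>2) ^ n * f x)"
    using gauss_expectation_norm_mult[OF hom_poly_mult[OF hom_poly_norm_power[OF order_refl] assms(1)],
        of n] by (simp add: mult_ac add_ac)
  moreover have "rdf (int (D + k + 2 * Suc n) - 2) =
      real (D + k + 2 * n) * rdf (int (D + k + 2 * n) - 2)"
    using rdf_rec[of "int (D + k + 2 * Suc n) - 2"] assms(2) by (simp add: algebra_simps)
  ultimately show ?case using Suc.IH by (simp only: mult.assoc)
qed simp

text \<open>Separates the last variable as Fubini would, but by reading off monomials with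
  \<open>gauss_expectation_monom\<close>.\<close>

lemma gauss_expectation_Suc:
  assumes "hom_poly k D f"
  shows "gauss_expectation (Suc k) (\<lambda>x. x k ^ j * f x) = normal_moment j * gauss_expectation k f"
  using assms
proof (induction rule: hom_poly.induct)
  case hom_poly_zero
  then show ?case by (simp add: gauss_expectation_zero)
next
  case (hom_poly_add_monom f \<gamma> c)
  let ?M = "\<lambda>x :: nat \<Rightarrow> real. \<Prod>i<k. x i ^ \<gamma> i"
    and ?N = "\<lambda>x :: nat \<Rightarrow> real. \<Prod>i<Suc k. x i ^ (\<gamma>(k := j)) i"
  have "gauss_expectation (Suc k) (\<lambda>x. x k ^ j * (f x + c * ?M x)) =
      gauss_expectation (Suc k) (\<lambda>x. x k ^ j * f x + c * ?N x)"
    by (simp add: algebra_simps)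
  also have "\<dots> = gauss_expectation (Suc k) (\<lambda>x. x k ^ j * f x) + c * gauss_expectation (Suc k) ?N"
    by (subst gauss_expectation_add)
       (auto intro: gauss_integrable_cmult gauss_integrable_monom
          gauss_integrable_hom_poly[OF hom_poly_Suc[OF hom_poly_add_monom(1)]]
          simp: gauss_expectation_cmult simp del: prod.lessThan_Suc)
  also have "gauss_expectation (Suc k) ?N = normal_moment j * gauss_expectation k ?M"
    unfolding gauss_expectation_monom by simp
  also have "gauss_expectation (Suc k) (\<lambda>x. x k ^ j * f x) + c * (normal_moment j * gauss_expectation k ?M) =
      normal_moment j * (gauss_expectation k f + c * gauss_expectation k ?M)"
    unfolding hom_poly_add_monom by (simp add: algebra_simps)
  also have "gauss_expectation k f + c * gauss_expectation k ?M =
      gauss_expectation k (\<lambda>x. f x + c * ?M x)"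
    by (subst gauss_expectation_add)
       (auto intro: gauss_integrable_cmult gauss_integrable_monom
          gauss_integrable_hom_poly[OF hom_poly_add_monom(1)] simp: gauss_expectation_cmult)
  finally show ?case .
qed

text \<open>Expand both homogenizations. The term with x_k^(i+j) yields
  \<open>normal_moment (i + j)\<close>, and its power of r^2 yields (m - i - j - 2)!! / (a + b + k -
  2)!! with m = a + b + n + l + k. These are the weights of the functional at u^(i+j), so the sum is
  its value at p q.\<close>

lemma gauss_form_homogenize:
  assumes f: "hom_poly k a f" and g: "hom_poly k b g" and "k > 0"
    and p: "degree p \<le> n" "\<And>j. coeff p j \<noteq> 0 \<Longrightarrow> even (n - j)"
    and q: "degree q \<le> l" "\<And>j. coeff q j \<noteq> 0 \<Longrightarrow> even (l - j)"
  shows "gauss_form (Suc k) (\<lambda>x. homogenize n p (x k) (\<Sum>i<k. (x i)\<^sup>2) * f x)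
      (\<lambda>x. homogenize l q (x k) (\<Sum>i<k. (x i)\<^sup>2) * g x) * rdf (int (a + b + k) - 2) =
    romanovski_functional (int (a + b + n + l + k)) (p * q) * gauss_form k f g"
proof -
  let ?s = "\<lambda>x :: nat \<Rightarrow> real. \<Sum>i<k. (x i)\<^sup>2"
  let ?e = "\<lambda>i j. (n - i) div 2 + (l - j) div 2"
  let ?T = "\<lambda>i j x. x k ^ (i + j) * (?s x ^ ?e i j * (f x * g x))"
  let ?m = "int (a + b + n + l + k)"
  have fg: "hom_poly k (a + b) (\<lambda>x. f x * g x)" by (rule hom_poly_mult[OF f g])
  have sfg: "hom_poly k (2 * e + (a + b)) (\<lambda>x. ?s x ^ e * (f x * g x))" for e
    by (rule hom_poly_mult[OF hom_poly_norm_power[OF order_refl] fg])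
  have int: "gauss_integrable (Suc k) (\<lambda>x. (coeff p i * coeff q j) * ?T i j x)" for i j
    by (intro gauss_integrable_cmult gauss_integrable_hom_poly[OF hom_poly_Suc[OF sfg]])
  have int_sum: "gauss_integrable (Suc k) (\<lambda>x. \<Sum>j\<le>l. (coeff p i * coeff q j) * ?T i j x)" for i
    by (rule gauss_integrable_sum) (rule int)
  have expand: "(homogenize n p (x k) (?s x) * f x) * (homogenize l q (x k) (?s x) * g x) =
      (\<Sum>i\<le>n. \<Sum>j\<le>l. (coeff p i * coeff q j) * ?T i j x)" for x
  proof -
    have "(homogenize n p (x k) (?s x) * f x) * (homogenize l q (x k) (?s x) * g x) =
        (homogenize n p (x k) (?s x) * homogenize l q (x k) (?s x)) * (f x * g x)"
      by (simp only: mult_ac)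
    also have "\<dots> = (\<Sum>i\<le>n. \<Sum>j\<le>l. (coeff p i * coeff q j) * ?T i j x)"
      unfolding homogenize_def sum_product
      unfolding sum_distrib_right
      by (intro sum.cong refl) (simp only: power_add mult_ac)
    finally show ?thesis .
  qed
  have T: "(coeff p i * coeff q j) * gauss_expectation (Suc k) (?T i j) * rdf (int (a + b + k) - 2) =
      (coeff p i * coeff q j) * (normal_moment (i + j) * rdf (?m - int (i + j) - 2)) * gauss_form k f g"
    if "i \<le> n" "j \<le> l" for i j
  proof (cases "coeff p i = 0 \<or> coeff q j = 0")
    case False
    \<comment> \<open>Nonzero coefficients have the right parity, so the halved exponents of r^2
      double back to n - i and l - j exactly.\<close>
    have "int (2 * ((n - i) div 2)) = int n - int i" "int (2 * ((l - j) div 2)) = int l - int j"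
      using False p(2)[of i] q(2)[of j] that by simp_all
    then have e: "int (a + b + k + 2 * ?e i j) - 2 = ?m - int (i + j) - 2"
      by simp
    have "gauss_expectation (Suc k) (?T i j) * rdf (int (a + b + k) - 2) =
        normal_moment (i + j) * (gauss_expectation k (\<lambda>x. ?s x ^ ?e i j * (f x * g x)) *
          rdf (int (a + b + k) - 2))"
      by (simp add: gauss_expectation_Suc[OF sfg])
    also have "\<dots> = normal_moment (i + j) * (rdf (?m - int (i + j) - 2) * gauss_form k f g)"
      using gauss_expectation_norm_power_mult[OF fg, of "?e i j"] \<open>k > 0\<close>
      by (simp only: e gauss_form_eq_expectation)
    finally show ?thesis by (simp only: mult.assoc)
  qed auto
  have "gauss_form (Suc k) (\<lambda>x. homogenize n p (x k) (?s x) * f x)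
      (\<lambda>x. homogenize l q (x k) (?s x) * g x) =
      (\<Sum>i\<le>n. \<Sum>j\<le>l. (coeff p i * coeff q j) * gauss_expectation (Suc k) (?T i j))"
    unfolding gauss_form_eq_expectation expand
    by (simp only: gauss_expectation_sum[OF int_sum] gauss_expectation_sum[OF int] gauss_expectation_cmult)
  then have "gauss_form (Suc k) (\<lambda>x. homogenize n p (x k) (?s x) * f x)
      (\<lambda>x. homogenize l q (x k) (?s x) * g x) * rdf (int (a + b + k) - 2) =
      (\<Sum>i\<le>n. \<Sum>j\<le>l. (coeff p i * coeff q j) * (normal_moment (i + j) * rdf (?m - int (i + j) - 2)) *
        gauss_form k f g)"
    by (simp only: sum_distrib_right) (intro sum.cong refl T, auto)
  also have "\<dots> = romanovski_functional ?m (p * q) * gauss_form k f g"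
  proof -
    have "p * q = (\<Sum>i\<le>n. monom (coeff p i) i) * (\<Sum>j\<le>l. monom (coeff q j) j)"
      by (simp only: poly_as_sum_of_monoms'[OF p(1)] poly_as_sum_of_monoms'[OF q(1)])
    also have "\<dots> = (\<Sum>i\<le>n. \<Sum>j\<le>l. monom (coeff p i * coeff q j) (i + j))"
      by (simp only: sum_product mult_monom)
    finally show ?thesis
      by (simp only: romanovski_functional_sum romanovski_functional_monom sum_distrib_right)
  qed
  finally show ?thesis .
qed

section \<open>The polynomials $h_\alpha$\<close>

lemma coeff_monom_nonzero: "coeff (monom (1::real) n) j \<noteq> 0 \<Longrightarrow> even (n - j)"
  by (auto split: if_splits)

text \<open>Gives x^alpha the same product shape as h_alpha, so that
  \<open>gauss_form_homogenize\<close> covers both.\<close>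

lemma homogenize_monom: "homogenize n (monom 1 n) t s = t ^ n"
proof -
  have "homogenize n (monom 1 n) t s = (\<Sum>j\<le>n. if j = n then t ^ n else 0)"
    unfolding homogenize_def by (intro sum.cong) auto
  then show ?thesis by simp
qed

lemma monomial_fun_snoc: "monomial_fun (\<alpha> @ [a]) x = x (length \<alpha>) ^ a * monomial_fun \<alpha> x"
  by (simp add: monomial_fun_def nth_append)

lemma gauss_form_commute: "gauss_form k f g = gauss_form k g f"
  by (simp add: gauss_form_def mult.commute)

declare h_fun.simps(3) [simp del]

section \<open>Splitting off the last entries of two multi-indices of equal total degree\<close>

context
  fixes \<alpha> \<beta> :: "nat list" and a b d :: nat and m :: int
  assumes len: "length \<alpha> = d" "length \<beta> = d" and "d > 0"
    and sum: "sum_list \<alpha> + a = sum_list \<beta> + b"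
  defines "m \<equiv> int (2 * (sum_list \<alpha> + a) + d)"
begin

private lemma h_fun_snoc:
  "h_fun (\<alpha> @ [a]) x = homogenize a (p_poly a m) (x d) (\<Sum>i<d. (x i)\<^sup>2) * h_fun \<alpha> x"
  "h_fun (\<beta> @ [b]) x = homogenize b (p_poly b m) (x d) (\<Sum>i<d. (x i)\<^sup>2) * h_fun \<beta> x"
  using h_fun.simps(3)[of \<alpha> a x] h_fun.simps(3)[of \<beta> b x] sum len \<open>d > 0\<close>
  by (force simp: m_def)+

text \<open>By equality of the total degrees, the parameter of the functional produced by
  \<open>gauss_form_homogenize\<close> is the upper index of both p_a and p_b.\<close>

private lemma m_eq: "int (sum_list \<alpha> + sum_list \<beta> + a + b + d) = m"
  using sum by (simp add: m_def)

lemma gauss_form_h_h: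
  "gauss_form (Suc d) (h_fun (\<alpha> @ [a])) (h_fun (\<beta> @ [b])) *
      rdf (int (sum_list \<alpha> + sum_list \<beta> + d) - 2) =
    romanovski_functional m (p_poly a m * p_poly b m) * gauss_form d (h_fun \<alpha>) (h_fun \<beta>)"
  unfolding h_fun_snoc[abs_def]
  using gauss_form_homogenize[where p = "p_poly a m" and q = "p_poly b m",
      OF hom_poly_h_fun[of \<alpha>, unfolded len] hom_poly_h_fun[of \<beta>, unfolded len]
    \<open>d > 0\<close> degree_p_poly even_if_coeff_p_poly_nonzero degree_p_poly even_if_coeff_p_poly_nonzero]
  by (simp only: m_eq)

lemma gauss_form_monomial_h:
  "gauss_form (Suc d) (monomial_fun (\<alpha> @ [a])) (h_fun (\<beta> @ [b])) *
      rdf (int (sum_list \<alpha> + sum_list \<beta> + d) - 2) =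
    romanovski_functional m (monom 1 a * p_poly b m) * gauss_form d (monomial_fun \<alpha>) (h_fun \<beta>)"
  unfolding h_fun_snoc[abs_def] monomial_fun_snoc[abs_def] len
  using gauss_form_homogenize[where p = "monom 1 a" and q = "p_poly b m",
      OF hom_poly_monomial_fun[of \<alpha>, unfolded len] hom_poly_h_fun[of \<beta>, unfolded len]
    \<open>d > 0\<close> degree_monom_le coeff_monom_nonzero[of a] degree_p_poly even_if_coeff_p_poly_nonzero[of b m]]
  by (simp only: m_eq homogenize_monom simp_thms)

private lemma degree_bounds: "2 * int a < m" "2 * int b < m"
  using \<open>d > 0\<close> sum by (auto simp: m_def)

text \<open>p_a^m has degree at most a < b, so its coefficient at b is zero and the functional
  vanishes; the double factorial in \<open>gauss_form_h_h\<close> is nonzero and cancels.\<close>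

lemma gauss_form_h_h_last_less:
  assumes "a < b"
  shows "gauss_form (Suc d) (h_fun (\<alpha> @ [a])) (h_fun (\<beta> @ [b])) = 0"
  using gauss_form_h_h romanovski_functional_mult_p_poly[OF order_trans[OF degree_p_poly less_imp_le[OF assms]]
      degree_bounds(2), of m] assms
  by (simp add: coeff_p_poly)

lemma gauss_form_monomial_h_last_less:
  assumes "a < b"
  shows "gauss_form (Suc d) (monomial_fun (\<alpha> @ [a])) (h_fun (\<beta> @ [b])) = 0"
  using gauss_form_monomial_h romanovski_functional_p_poly_orthogonal[OF assms degree_bounds(2)]
  by simp

end

section \<open>Norm, orthogonality and triangularity\<close>

lemma gauss_form_h_fun_self:
  assumes "\<alpha> \<noteq> []"
  shows "gauss_form (Suc (length \<alpha>)) (h_fun (\<alpha> @ [a])) (h_fun (\<alpha> @ [a])) =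
    fact a * (rdf (2 * int (sum_list \<alpha>) + int (length \<alpha>)) *
      rdf (2 * int (sum_list \<alpha> + a) + int (length \<alpha>) - 1) /
      fact (sum_list \<alpha> + (sum_list \<alpha> + a) + length \<alpha>)) * gauss_form (length \<alpha>) (h_fun \<alpha>) (h_fun \<alpha>)"
proof -
  \<comment> \<open>This is m - 2a, the invariant of
    \<open>romanovski_functional_p_poly_norm\<close>, and also twice the degree of the prefix plus
    the dimension; hence the (M - 2)!! in the norm cancels the one in
    \<open>gauss_form_h_h\<close>.\<close>
  let ?M = "2 * sum_list \<alpha> + length \<alpha>"
  let ?m = "int (2 * (sum_list \<alpha> + a) + length \<alpha>)"
  have M: "int ?M + 2 * int a = ?m" by simp
  have len: "length \<alpha> > 0" using assms by simp
  \<comment> \<open>One factor p_a is monic of degree a and may be replaced by u^a.\<close>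
  have "romanovski_functional ?m (p_poly a ?m * p_poly a ?m) =
      romanovski_functional ?m (monom 1 a * p_poly a ?m)"
    using romanovski_functional_mult_p_poly[OF degree_p_poly[of a ?m], of ?m] len
    by (simp add: coeff_p_poly_self)
  also have "\<dots> = fact a * rdf (int ?M) * rdf (int ?M - 2) * rdf (?m - 1) / fact (?M + a)"
    using romanovski_functional_p_poly_norm[of ?M a] len unfolding M by simp
  finally have functional: "romanovski_functional ?m (p_poly a ?m * p_poly a ?m) =
    fact a * rdf (int ?M) * rdf (int ?M - 2) * rdf (?m - 1) / fact (?M + a)" .
  have "sum_list \<alpha> + sum_list \<alpha> + length \<alpha> = ?M" by simp
  then have "gauss_form (Suc (length \<alpha>)) (h_fun (\<alpha> @ [a])) (h_fun (\<alpha> @ [a])) * rdf (int ?M - 2) =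
      fact a * rdf (int ?M) * rdf (int ?M - 2) * rdf (?m - 1) / fact (?M + a) *
      gauss_form (length \<alpha>) (h_fun \<alpha>) (h_fun \<alpha>)"
    using gauss_form_h_h[OF refl refl len refl, of a] by (simp only: functional)
  then have "rdf (int ?M - 2) * gauss_form (Suc (length \<alpha>)) (h_fun (\<alpha> @ [a])) (h_fun (\<alpha> @ [a])) =
      rdf (int ?M - 2) * (fact a * (rdf (int ?M) * rdf (?m - 1) / fact (?M + a)) *
      gauss_form (length \<alpha>) (h_fun \<alpha>) (h_fun \<alpha>))"
    by (simp only: mult_ac times_divide_eq_left times_divide_eq_right)
  then have "gauss_form (Suc (length \<alpha>)) (h_fun (\<alpha> @ [a])) (h_fun (\<alpha> @ [a])) =
      fact a * (rdf (int ?M) * rdf (?m - 1) / fact (?M + a)) *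
      gauss_form (length \<alpha>) (h_fun \<alpha>) (h_fun \<alpha>)"
    unfolding mult_left_cancel[OF rdf_nonzero] .
  moreover have "?M + a = sum_list \<alpha> + (sum_list \<alpha> + a) + length \<alpha>"
    "int ?M = 2 * int (sum_list \<alpha>) + int (length \<alpha>)"
    "?m = 2 * int (sum_list \<alpha> + a) + int (length \<alpha>)"
    by simp_all
  ultimately show ?thesis by (simp only:)
qed

text \<open>Compare last entries. If they differ, the polynomials in the slope are orthogonal, with
  symmetry of the form covering both orders; if they agree, the prefixes differ but have equal sums,
  and induction applies.\<close>

lemma gauss_form_h_fun_orthogonal:
  assumes "length \<alpha> = length \<beta>" "sum_list \<alpha> = sum_list \<beta>" "\<alpha> \<noteq> \<beta>"
  shows "gauss_form (length \<beta>) (h_fun \<alpha>) (h_fun \<beta>) = 0"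
  using assms
proof (induction \<alpha> arbitrary: \<beta> rule: rev_induct)
  case (snoc a \<alpha>)
  obtain \<gamma> b where \<beta>: "\<beta> = \<gamma> @ [b]" using snoc.prems by (cases \<beta> rule: rev_cases) auto
  \<comment> \<open>The prefixes are nonempty because single-entry multi-indices with equal sums
    coincide.\<close>
  have len: "length \<alpha> = length \<gamma>" "length \<gamma> > 0"
    and sum: "sum_list \<alpha> + a = sum_list \<gamma> + b"
    using snoc.prems by (auto simp: \<beta>)
  consider "a < b" | "b < a" | "a = b" "\<alpha> \<noteq> \<gamma>" using snoc.prems(3) \<beta> by force
  then show ?case
  proof cases
    case 1
    then show ?thesis using gauss_form_h_h_last_less[OF len(1) refl len(2) sum] by (simp add: \<beta>)
  next
    case 2
    then show ?thesis
      using gauss_form_h_h_last_less[OF refl len(1) _ sum[symmetric]] len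
        gauss_form_commute[of "length \<beta>" "h_fun \<beta>" "h_fun (\<alpha> @ [a])"]
      by (simp add: \<beta>)
  next
    case 3
    then have "gauss_form (length \<gamma>) (h_fun \<alpha>) (h_fun \<gamma>) = 0"
      using snoc.IH len sum by simp
    then show ?thesis using gauss_form_h_h[OF len(1) refl len(2) sum] by (simp add: \<beta>)
  qed
qed simp

text \<open>In one variable x^alpha and h_alpha coincide. Otherwise, p_a being monic, u^a and p_a
  pair equally with p_a, and the prefixes are handled by induction.\<close>

lemma gauss_form_monomial_h_fun_self:
  "\<alpha> \<noteq> [] \<Longrightarrow> gauss_form (length \<alpha>) (monomial_fun \<alpha>) (h_fun \<alpha>) =
    gauss_form (length \<alpha>) (h_fun \<alpha>) (h_fun \<alpha>)"
proof (induction \<alpha> rule: rev_nonempty_induct)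
  case (single a)
  have "h_fun [a] = monomial_fun [a]" by (auto simp: monomial_fun_def)
  then show ?case by simp
next
  case (snoc a \<alpha>)
  let ?m = "int (2 * (sum_list \<alpha> + a) + length \<alpha>)"
  have len: "length \<alpha> > 0" using snoc.hyps by simp
  have "romanovski_functional ?m (p_poly a ?m * p_poly a ?m) =
      romanovski_functional ?m (monom 1 a * p_poly a ?m)"
    using romanovski_functional_mult_p_poly[OF degree_p_poly[of a ?m], of ?m] len
    by (simp add: coeff_p_poly_self)
  then have "gauss_form (Suc (length \<alpha>)) (monomial_fun (\<alpha> @ [a])) (h_fun (\<alpha> @ [a])) *
      rdf (int (sum_list \<alpha> + sum_list \<alpha> + length \<alpha>) - 2) =
    gauss_form (Suc (length \<alpha>)) (h_fun (\<alpha> @ [a])) (h_fun (\<alpha> @ [a])) *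
      rdf (int (sum_list \<alpha> + sum_list \<alpha> + length \<alpha>) - 2)"
    by (simp only: gauss_form_h_h[OF refl refl len refl] gauss_form_monomial_h[OF refl refl len refl]
        snoc.IH)
  then show ?case by simp
qed

text \<open>Follows the two rules of the order: a smaller last entry makes u^a orthogonal to p_b,
  while equal last entries pass the claim to the prefixes.\<close>

lemma gauss_form_monomial_h_fun_less:
  fixes \<alpha> \<beta> :: "nat list"
  assumes "\<alpha> \<prec> \<beta>" "sum_list \<alpha> = sum_list \<beta>"
  shows "gauss_form (length \<beta>) (monomial_fun \<alpha>) (h_fun \<beta>) = 0"
  using assms
proof (induction rule: multi_index_less.induct)
  case (last_less \<alpha> \<beta> a b)
  \<comment> \<open>An empty prefix would force a = b by equality of sums, against a < b.\<close>
  then have len: "length \<beta> > 0" by (cases "\<beta> = []") auto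
  then show ?case
    using gauss_form_monomial_h_last_less[OF last_less(1) refl len _ last_less(2)] last_less(3) by simp
next
  case (last_eq \<alpha> \<beta> a)
  then have len: "length \<alpha> = length \<beta>" "length \<beta> > 0"
    using multi_index_less_length multi_index_less_Nil by fastforce+
  then show ?case
    using gauss_form_monomial_h[OF len(1) refl len(2)] last_eq by simp
qed

theorem theorem4p15:
  fixes d :: nat and \<alpha> \<beta> :: "nat list"
  assumes "length \<alpha> = d + 1" and "length \<beta> = d + 1"
    and "sum_list \<alpha> = sum_list \<beta>"
  shows "(d \<ge> 1 \<longrightarrow>
      gauss_form (d + 1) (h_fun \<alpha>) (h_fun \<alpha>) =
        fact (last \<alpha>) *
        (of_int (double_fact (2 * int (sum_list (butlast \<alpha>)) + int d)) *
          of_int (double_fact (2 * int (sum_list \<alpha>) + int d - 1)) /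
          fact (sum_list (butlast \<alpha>) + sum_list \<alpha> + d)) *
        gauss_form d (h_fun (butlast \<alpha>)) (h_fun (butlast \<alpha>))) \<and>
    (\<alpha> \<noteq> \<beta> \<longrightarrow> gauss_form (d + 1) (h_fun \<alpha>) (h_fun \<beta>) = 0) \<and>
    gauss_form (d + 1) (monomial_fun \<alpha>) (h_fun \<alpha>) =
      gauss_form (d + 1) (h_fun \<alpha>) (h_fun \<alpha>) \<and>
    (\<alpha> \<prec> \<beta> \<longrightarrow> gauss_form (d + 1) (monomial_fun \<alpha>) (h_fun \<beta>) = 0)"
proof (intro conjI impI)
  assume "d \<ge> 1"
  obtain \<gamma> a where \<alpha>: "\<alpha> = \<gamma> @ [a]" using assms(1) by (cases \<alpha> rule: rev_cases) auto
  have \<gamma>: "length \<gamma> = d" "\<gamma> \<noteq> []" using assms(1) \<open>d \<ge> 1\<close> by (auto simp: \<alpha>)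
  have sum: "sum_list \<alpha> = sum_list \<gamma> + a" by (simp add: \<alpha>)
  show "gauss_form (d + 1) (h_fun \<alpha>) (h_fun \<alpha>) =
        fact (last \<alpha>) *
        (of_int (double_fact (2 * int (sum_list (butlast \<alpha>)) + int d)) *
          of_int (double_fact (2 * int (sum_list \<alpha>) + int d - 1)) /
          fact (sum_list (butlast \<alpha>) + sum_list \<alpha> + d)) *
        gauss_form d (h_fun (butlast \<alpha>)) (h_fun (butlast \<alpha>))"
    using gauss_form_h_fun_self[OF \<gamma>(2), of a] unfolding sum
    by (simp only: \<alpha> \<gamma>(1) butlast_snoc last_snoc Suc_eq_plus1)
next
  assume "\<alpha> \<noteq> \<beta>"
  then show "gauss_form (d + 1) (h_fun \<alpha>) (h_fun \<beta>) = 0"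
    using gauss_form_h_fun_orthogonal[of \<alpha> \<beta>] assms by simp
next
  show "gauss_form (d + 1) (monomial_fun \<alpha>) (h_fun \<alpha>) = gauss_form (d + 1) (h_fun \<alpha>) (h_fun \<alpha>)"
    using gauss_form_monomial_h_fun_self[of \<alpha>] assms by fastforce
next
  assume "\<alpha> \<prec> \<beta>"
  then show "gauss_form (d + 1) (monomial_fun \<alpha>) (h_fun \<beta>) = 0"
    using gauss_form_monomial_h_fun_less[of \<alpha> \<beta>] assms by simp
qed

end
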